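(* Let $T\in(0,\infty)$, let $(\Omega,\mathcal{F},\mathbb{P})$ be a probability space with a normal filtration $(\mathcal{F}_t)_{t\in[0,T]}$, let $W\colon[0,T]\times\Omega\to\mathbb{R}$ be a one-dimensional standard $(\mathcal{F}_t)_{t\in[0,T]}$-Brownian motion, let $\xi\colon\Omega\to\mathbb{R}$ be $\mathcal{F}_0/\mathcal{B}(\mathbb{R})$-measurable, and let $\mu,\sigma\colon\mathbb{R}\to\mathbb{R}$ be $\mathcal{B}(\mathbb{R})/\mathcal{B}(\mathbb{R})$-measurable functions. Let $X\colon[0,T]\times\Omega\to\mathbb{R}$ be a predictable stochastic process satisfying $$\mathbb{P}\left[\int_0^T |\mu(X_s)|+|\sigma(X_s)|^2\,ds<\infty\right]=1$$ and $$\mathbb{P}\left[X_t=\xi+\int_0^t\mu(X_s)\,ds+\int_0^t\sigma(X_s)\,dW_s\right]=1\quad\text{for all } t\in[0,T].$$ For $N\in\mathbb{N}$ and $n\in\{0,1,\dots,N\}$ let $Y^N_n\colon\Omega\to\mathbb{R}$ be the Euler approximations given by $Y^N_0(\omega):=\xi(\omega)$ and $$Y^N_{n+1}(\omega):=Y^N_n(\omega)+\frac{T}{N}\cdot\mu\big(Y^N_n(\omega)\big)+\sigma\big(Y^N_n(\omega)\big)\cdot\Big(W_{\frac{(n+1)T}{N}}(\omega)-W_{\frac{nT}{N}}(\omega)\Big)$$ for all $n\in\{0,1,\dots,N-1\}$, $N\in\mathbb{N}$ and $\omega\in\Omega$. Assume that $\mathbb{P}[\sigma(\xi)\neq 0]>0$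 and let $C\geq 1$ and $\beta>\alpha>1$ be constants such that $$\max\big(|\mu(x)|,|\sigma(x)|\big)\geq\frac{|x|^{\beta}}{C}\quad\text{and}\quad\min\big(|\mu(x)|,|\sigma(x)|\big)\leq C|x|^{\alpha}$$ for all $x\in\mathbb{R}$ with $|x|\geq C$. Then there exist a constant $c\in(1,\infty)$ and a sequence of nonempty events $\Omega_N\in\mathcal{F}$, $N\in\mathbb{N}$, with $$\mathbb{P}[\Omega_N]\geq c^{(-N^c)}\quad\text{and}\quad |Y^N_N(\omega)|\geq 2^{\left(\alpha^{(N-1)}\right)}$$ for all $\omega\in\Omega_N$ and all $N\in\mathbb{N}$. Moreover, if $p\in[1,\infty)$ is such that $\mathbb{E}\big[|X_T|^p\big]<\infty$, then $$\lim_{N\to\infty}\mathbb{E}\Big[\big|X_T-Y^N_N\big|^p\Big]=\infty\quad\text{and}\quad\lim_{N\to\infty}\Big|\mathbb{E}\big[|X_T|^p\big]-\mathbb{E}\big[|Y^N_N|^p\big]\Big|=\infty.$$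
   Context: $\mathbb{N}=\{1,2,3,\dots\}$, and $\mathcal{B}(\mathbb{R})$ is the Borel $\sigma$-algebra of $\mathbb{R}$. A filtration $(\mathcal{F}_t)_{t\in[0,T]}$ is normal if it is right-continuous and $\mathcal{F}_0$ contains all $\mathbb{P}$-null sets of $\mathcal{F}$. A standard $(\mathcal{F}_t)$-Brownian motion is a Brownian motion started at $0$ that is adapted to $(\mathcal{F}_t)$ and whose increments $W_t-W_s$, $s\le t$, are independent of $\mathcal{F}_s$. The process $X$ is a solution of the stochastic differential equation $dX_t=\mu(X_t)\,dt+\sigma(X_t)\,dW_t$, $X_0=\xi$, $t\in[0,T]$, with the stochastic integral understood in the Itô sense. Expectations of nonnegative random variables take values in $[0,\infty]$. *)

theory Defs
  imports "HOL-Probability.Probability"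
begin

text \<open>
  Processes and filtrations indexed by \<open>[0, T]\<close> are total functions of a real time parameter;
  only their values at times in \<open>{0..T}\<close> are ever constrained or used.
\<close>

definition normal_filtration :: "'a measure \<Rightarrow> real \<Rightarrow> (real \<Rightarrow> 'a measure) \<Rightarrow> bool" where
  "normal_filtration M T F \<longleftrightarrow>
     (\<forall>t\<in>{0..T}. subalgebra M (F t)) \<and>
     (\<forall>s\<in>{0..T}. \<forall>t\<in>{s..T}. sets (F s) \<subseteq> sets (F t)) \<and>
     (\<forall>t\<in>{0..<T}. sets (F t) = (\<Inter>s\<in>{t<..T}. sets (F s))) \<and>
     null_sets M \<subseteq> sets (F 0)"

text \<open>
  Independence of the increments among each other follows from adaptedness and the
  independence of \<open>W t - W s\<close> from \<open>F s\<close>. The initial value and path continuity are only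
  required almost surely.
\<close>

definition standard_brownian_motion ::
    "'a measure \<Rightarrow> real \<Rightarrow> (real \<Rightarrow> 'a measure) \<Rightarrow> (real \<Rightarrow> 'a \<Rightarrow> real) \<Rightarrow> bool" where
  "standard_brownian_motion M T F W \<longleftrightarrow>
     (\<forall>t\<in>{0..T}. W t \<in> borel_measurable (F t)) \<and>
     (AE \<omega> in M. W 0 \<omega> = 0) \<and>
     (AE \<omega> in M. continuous_on {0..T} (\<lambda>t. W t \<omega>)) \<and>
     (\<forall>s\<in>{0..T}. \<forall>t\<in>{s<..T}.
        distributed M lborel (\<lambda>\<omega>. W t \<omega> - W s \<omega>)
          (\<lambda>x. ennreal (normal_density 0 (sqrt (t - s)) x)) \<and>
        prob_space.indep_set M (sets (F s))
          (sets (vimage_algebra (space M) (\<lambda>\<omega>. W t \<omega> - W s \<omega>) borel)))"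

definition predictable_algebra ::
    "'a measure \<Rightarrow> real \<Rightarrow> (real \<Rightarrow> 'a measure) \<Rightarrow> (real \<times> 'a) measure" where
  "predictable_algebra M T F =
     sigma ({0..T} \<times> space M)
       ({{0} \<times> A | A. A \<in> sets (F 0)} \<union>
        {{s<..t} \<times> A | s t A. 0 \<le> s \<and> s < t \<and> t \<le> T \<and> A \<in> sets (F s)})"

definition predictable_process ::
    "'a measure \<Rightarrow> real \<Rightarrow> (real \<Rightarrow> 'a measure) \<Rightarrow> (real \<Rightarrow> 'a \<Rightarrow> real) \<Rightarrow> bool" where
  "predictable_process M T F H \<longleftrightarrow>
     (\<lambda>(t, \<omega>). H t \<omega>) \<in> borel_measurable (predictable_algebra M T F)"

subsection \<open>The Ito integral\<close>

text \<open>
  The triple \<open>(k, \<tau>, \<Phi>)\<close> encodes the elementary process that equals \<open>\<Phi> i\<close> on the time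
  interval \<open>{\<tau> i<..\<tau> (Suc i)}\<close> for \<open>i < k\<close> and vanishes elsewhere.
\<close>

definition elementary_data ::
    "'a measure \<Rightarrow> real \<Rightarrow> (real \<Rightarrow> 'a measure) \<Rightarrow>
     nat \<Rightarrow> (nat \<Rightarrow> real) \<Rightarrow> (nat \<Rightarrow> 'a \<Rightarrow> real) \<Rightarrow> bool" where
  "elementary_data M T F k \<tau> \<Phi> \<longleftrightarrow>
     0 \<le> \<tau> 0 \<and> (\<forall>i<k. \<tau> i \<le> \<tau> (Suc i)) \<and> \<tau> k \<le> T \<and>
     (\<forall>i<k. \<Phi> i \<in> borel_measurable (F (\<tau> i)) \<and> bounded (\<Phi> i ` space M))"

definition elementary_process ::
    "nat \<Rightarrow> (nat \<Rightarrow> real) \<Rightarrow> (nat \<Rightarrow> 'a \<Rightarrow> real) \<Rightarrow> real \<Rightarrow> 'a \<Rightarrow> real" where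
  "elementary_process k \<tau> \<Phi> s \<omega> = (\<Sum>i<k. \<Phi> i \<omega> * indicator {\<tau> i<..\<tau> (Suc i)} s)"

definition elementary_integral ::
    "(real \<Rightarrow> 'a \<Rightarrow> real) \<Rightarrow> nat \<Rightarrow> (nat \<Rightarrow> real) \<Rightarrow> (nat \<Rightarrow> 'a \<Rightarrow> real) \<Rightarrow>
     real \<Rightarrow> 'a \<Rightarrow> real" where
  "elementary_integral W k \<tau> \<Phi> t \<omega> =
     (\<Sum>i<k. \<Phi> i \<omega> * (W (min (\<tau> (Suc i)) t) \<omega> - W (min (\<tau> i) t) \<omega>))"

text \<open>
  \<open>J\<close> is a version of the process \<open>\<integral>\<^sub>0\<^sup>t H dW\<close>, \<open>t \<in> [0, T]\<close>: it is adapted with almost surely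
  continuous paths, and it is the limit in probability of the integrals of elementary
  processes \<open>\<phi>\<^sub>n\<close> such that \<open>\<integral>\<^sub>0\<^sup>T \<bar>\<phi>\<^sub>n - H\<bar>\<^sup>2 ds\<close> tends to \<open>0\<close> in probability. For a Brownian motion
  \<open>W\<close> relative to a normal filtration, such a \<open>J\<close> exists for every predictable \<open>H\<close> with
  \<open>\<integral>\<^sub>0\<^sup>T \<bar>H\<bar>\<^sup>2 ds < \<infinity>\<close> almost surely, and it is unique up to indistinguishability. Predictability of
  \<open>H\<close> and measurability of \<open>J t\<close> make the sets below measurable; this matters because
  \<open>measure\<close> is \<open>0\<close> on non-measurable sets.
\<close>

definition is_ito_integral ::
    "'a measure \<Rightarrow> real \<Rightarrow> (real \<Rightarrow> 'a measure) \<Rightarrow> (real \<Rightarrow> 'a \<Rightarrow> real) \<Rightarrow>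
     (real \<Rightarrow> 'a \<Rightarrow> real) \<Rightarrow> (real \<Rightarrow> 'a \<Rightarrow> real) \<Rightarrow> bool" where
  "is_ito_integral M T F W H J \<longleftrightarrow>
     predictable_process M T F H \<and>
     (\<forall>t\<in>{0..T}. J t \<in> borel_measurable (F t)) \<and>
     (AE \<omega> in M. continuous_on {0..T} (\<lambda>t. J t \<omega>)) \<and>
     (\<exists>k \<tau> \<Phi>.
        (\<forall>n. elementary_data M T F (k n) (\<tau> n) (\<Phi> n)) \<and>
        (\<forall>\<epsilon>>0. (\<lambda>n. measure M {\<omega> \<in> space M. ennreal \<epsilon> <
             (\<integral>\<^sup>+ s \<in> {0..T}.
                ennreal ((elementary_process (k n) (\<tau> n) (\<Phi> n) s \<omega> - H s \<omega>)\<^sup>2) \<partial>lborel)})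
           \<longlonglongrightarrow> 0) \<and>
        (\<forall>t\<in>{0..T}. \<forall>\<epsilon>>0. (\<lambda>n. measure M {\<omega> \<in> space M. \<epsilon> <
             \<bar>elementary_integral W (k n) (\<tau> n) (\<Phi> n) t \<omega> - J t \<omega>\<bar>}) \<longlonglongrightarrow> 0))"

definition ito_integral ::
    "'a measure \<Rightarrow> real \<Rightarrow> (real \<Rightarrow> 'a measure) \<Rightarrow> (real \<Rightarrow> 'a \<Rightarrow> real) \<Rightarrow>
     (real \<Rightarrow> 'a \<Rightarrow> real) \<Rightarrow> real \<Rightarrow> 'a \<Rightarrow> real" where
  "ito_integral M T F W H = (SOME J. is_ito_integral M T F W H J)"

subsection \<open>The Euler scheme\<close>

primrec euler_approx ::
    "real \<Rightarrow> (real \<Rightarrow> 'a \<Rightarrow> real) \<Rightarrow> ('a \<Rightarrow> real) \<Rightarrow> (real \<Rightarrow> real) \<Rightarrow> (real \<Rightarrow> real) \<Rightarrow>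
     nat \<Rightarrow> nat \<Rightarrow> 'a \<Rightarrow> real" where
  "euler_approx T W \<xi> \<mu> \<sigma> N 0 \<omega> = \<xi> \<omega>"
| "euler_approx T W \<xi> \<mu> \<sigma> N (Suc n) \<omega> =
     euler_approx T W \<xi> \<mu> \<sigma> N n \<omega>
     + T / real N * \<mu> (euler_approx T W \<xi> \<mu> \<sigma> N n \<omega>)
     + \<sigma> (euler_approx T W \<xi> \<mu> \<sigma> N n \<omega>)
       * (W (real (Suc n) * T / real N) \<omega> - W (real n * T / real N) \<omega>)"

end

theory Submission
  imports Defs "HOL-Real_Asymp.Real_Asymp"
begin

text \<open>
  The Euler scheme diverges because of an event whose probability is only exponentially small
  in a power of \<open>N\<close>, but on which the scheme grows doubly exponentially.

  Let \<open>h = T / N\<close>. Far from the origin one of the two coefficients is at least of order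
  \<open>\<bar>y\<bar> powr \<beta>\<close>, while the other is at most of the smaller order \<open>\<bar>y\<bar> powr \<alpha>\<close>. If the Brownian
  increment of the step has the same order of magnitude as \<open>h\<close>, the smaller contribution
  cannot compensate the dominant one, whichever coefficient and whatever signs it comes with, and
  the step maps \<open>y\<close> to a point of modulus at least \<open>\<bar>y\<bar> powr \<alpha>\<close>
  (\<open>euler_step_superlinear\<close>). This requires \<open>\<bar>y\<bar> powr (\<beta> - \<alpha>)\<close> to exceed a constant of order
  \<open>N\<close>, that is, \<open>\<bar>y\<bar>\<close> has to exceed a threshold that is polynomial in \<open>N\<close>. Since
  \<open>\<sigma> (\<xi> \<omega>) \<noteq> 0\<close> with positive probability, one large first increment of polynomial size carries
  the scheme past this threshold, and after that it is raised to the power \<open>\<alpha>\<close> in every step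
  (\<open>euler_doubly_exponential_growth\<close>).

  By independence the probability of this scenario is the product of the probabilities of its
  steps (\<open>prob_grid_increments\<close>). A Gaussian of variance \<open>h\<close> lies in \<open>{h..2 * h}\<close> with
  probability of order \<open>sqrt h\<close>, and it exceeds a polynomial in \<open>N\<close> with probability at least
  \<open>exp\<close> of minus a polynomial in \<open>N\<close>; so the product of all \<open>N\<close> factors still is at least \<open>exp\<close> of
  minus a power of \<open>N\<close> (\<open>excursion_event_prob_ge\<close>).

  The value \<open>2 powr (\<alpha> ^ (N - 1))\<close> beats this probability, hence the absolute moments of the
  scheme tend to infinity. If the corresponding moment of \<open>X T\<close> is finite, the divergence
  passes to the moments of the difference and to the difference of the moments
  (\<open>moments_diverge\<close>).
\<close>

section \<open>One Euler step far from the origin\<close>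

text \<open>
  Here \<open>m\<close> and \<open>s\<close> are drift and diffusion at \<open>y\<close>, and \<open>w\<close> is the Brownian increment. As \<open>\<bar>w\<bar>\<close> is
  comparable to \<open>h\<close>, the dominant term has size at least \<open>h * \<bar>y\<bar> powr \<beta> / C\<close> whether it is the
  drift or the diffusion, and the other one has size at most \<open>2 * h * C * \<bar>y\<bar> powr \<alpha>\<close>. The lower
  bound on \<open>\<bar>y\<bar> powr (\<beta> - \<alpha>)\<close> makes the first exceed the second by \<open>2 * \<bar>y\<bar> powr \<alpha>\<close>, of which
  at most one half is lost to the current value \<open>y\<close>.
\<close>

lemma euler_step_superlinear:
  fixes y m s h w C \<alpha> \<beta> :: real
  assumes large: "max (abs m) (abs s) \<ge> abs y powr \<beta> / C" and small: "min (abs m) (abs s) \<le> C * abs y powr \<alpha>"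
    and "C > 0" "h > 0" "1 \<le> \<alpha>" "1 \<le> abs y"
    and far: "C * (2 / h + 2 * C) \<le> abs y powr (\<beta> - \<alpha>)"
    and w: "h \<le> abs w" "abs w \<le> 2 * h"
  shows "abs y powr \<alpha> \<le> abs (y + h * m + s * w)"
proof -
  define P where "P = abs y powr \<alpha>"
  have P0: "P \<ge> 0" by (simp add: P_def)
  have yP: "abs y \<le> P"
    using powr_mono[of 1 \<alpha> "abs y"] assms by (simp add: P_def)
  have "abs y powr \<beta> = abs y powr (\<beta> - \<alpha>) * P"
    by (simp add: P_def flip: powr_add)
  also have "\<dots> \<ge> C * (2 / h + 2 * C) * P"
    using far P0 by (rule mult_right_mono)
  finally have "(2 / h + 2 * C) * P \<le> abs y powr \<beta> / C"
    using \<open>C > 0\<close> by (simp add: field_simps)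
  with large have "(2 / h + 2 * C) * P \<le> max (abs m) (abs s)" by linarith
  then have "h * ((2 / h + 2 * C) * P) \<le> h * max (abs m) (abs s)"
    using \<open>h > 0\<close> by (intro mult_left_mono) auto
  moreover have "h * ((2 / h + 2 * C) * P) = 2 * P + 2 * h * (C * P)"
    using \<open>h > 0\<close> by (simp add: field_simps)
  ultimately have big: "2 * P + 2 * h * (C * P) \<le> h * max (abs m) (abs s)" by (simp only:)
  have CP: "0 \<le> C * P" using P0 \<open>C > 0\<close> by simp
  have "h * max (abs m) (abs s) - 2 * h * (C * P) \<le> abs (h * m + s * w)"
  proof (cases "abs m \<le> abs s")
    case True
    have "abs (h * m) \<le> h * (C * P)"
      using True small \<open>h > 0\<close> by (simp add: P_def abs_mult)
    moreover have "0 \<le> h * (C * P)" using CP \<open>h > 0\<close> by simp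
    moreover have "h * max (abs m) (abs s) \<le> abs w * abs s"
      using True w by (simp add: mult_right_mono)
    then have "h * max (abs m) (abs s) \<le> abs (s * w)" by (simp only: abs_mult mult.commute)
    moreover have "abs (s * w) \<le> abs (h * m + s * w) + abs (h * m)"
      using abs_triangle_ineq4[of "h * m + s * w" "h * m"] by simp
    ultimately show ?thesis by (simp only: mult.assoc)
  next
    case False
    have "min (abs m) (abs s) = abs s" using False by (simp add: min_def)
    then have "abs s \<le> C * P" using small by (simp only: P_def)
    then have "abs w * abs s \<le> 2 * h * (C * P)"
      by (rule mult_mono[OF w(2)]) (use \<open>h > 0\<close> in simp_all)
    then have "abs (s * w) \<le> 2 * h * (C * P)" by (simp only: abs_mult mult.commute)
    moreover have "h * max (abs m) (abs s) = abs (h * m)"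
      using False \<open>h > 0\<close> by (simp add: abs_mult)
    moreover have "abs (h * m) \<le> abs (h * m + s * w) + abs (s * w)"
      using abs_triangle_ineq4[of "h * m + s * w" "s * w"] by simp
    ultimately show ?thesis by argo
  qed
  moreover have "abs (h * m + s * w) \<le> abs (y + h * m + s * w) + abs y"
    using abs_triangle_ineq4[of "y + h * m + s * w" y] by simp
  ultimately show ?thesis using big yP unfolding P_def[symmetric] by argo
qed

section \<open>Gaussian increments\<close>

text \<open>
  To the right of its mean the density decreases, so on \<open>{a..b}\<close> it is smallest at \<open>b\<close>.
\<close>

lemma (in prob_space) normal_prob_interval_ge:
  assumes D: "distributed M lborel Z (\<lambda>x. ennreal (normal_density 0 s x))"
    and "0 \<le> a" "a \<le> b" "0 < s"
  shows "(b - a) * normal_density 0 s b \<le> prob {\<omega> \<in> space M. Z \<omega> \<in> {a..b}}"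
proof -
  have mono: "normal_density 0 s b \<le> normal_density 0 s x" if "x \<in> {a..b}" for x
    using that assms
    by (auto simp: normal_density_def intro!: mult_left_mono divide_right_mono power_mono)
  have "ennreal ((b - a) * normal_density 0 s b)
      = (\<integral>\<^sup>+x. ennreal (normal_density 0 s b) * indicator {a..b} x \<partial>lborel)"
    using assms by (simp add: nn_integral_cmult_indicator ennreal_mult' mult.commute)
  also have "\<dots> \<le> (\<integral>\<^sup>+x. ennreal (normal_density 0 s x) * indicator {a..b} x \<partial>lborel)"
    using mono by (intro nn_integral_mono) (auto simp: indicator_def intro!: ennreal_leI)
  also have "\<dots> = emeasure M (Z -` {a..b} \<inter> space M)"
    using distributed_emeasure[OF D, of "{a..b}"] by simp
  also have "\<dots> = ennreal (prob {\<omega> \<in> space M. Z \<omega> \<in> {a..b}})"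
    by (auto simp: emeasure_eq_measure intro!: arg_cong[where f = prob])
  finally show ?thesis by (simp add: ennreal_le_iff)
qed

locale filtered_brownian_motion = prob_space M for M :: "'a measure" +
  fixes T :: real and F :: "real \<Rightarrow> 'a measure" and W :: "real \<Rightarrow> 'a \<Rightarrow> real"
  assumes T_pos: "0 < T"
    and normal: "normal_filtration M T F"
    and brownian: "standard_brownian_motion M T F W"
begin

lemma subalgebra_F: "t \<in> {0..T} \<Longrightarrow> subalgebra M (F t)"
  using normal by (auto simp: normal_filtration_def)

lemma subalgebra_F_mono: "0 \<le> s \<Longrightarrow> s \<le> t \<Longrightarrow> t \<le> T \<Longrightarrow> subalgebra (F t) (F s)"
  using normal subalgebra_F[of s] subalgebra_F[of t]
  by (auto simp: normal_filtration_def subalgebra_def)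

lemma increment_measurable:
  assumes "0 \<le> s" "s \<le> t" "t \<le> T"
  shows "(\<lambda>\<omega>. W t \<omega> - W s \<omega>) \<in> borel_measurable (F t)"
proof -
  have "W t \<in> borel_measurable (F t)" "W s \<in> borel_measurable (F s)"
    using brownian assms by (auto simp: standard_brownian_motion_def)
  moreover have "W s \<in> borel_measurable (F t)"
    by (rule measurable_from_subalg[OF subalgebra_F_mono[OF assms]]) fact
  ultimately show ?thesis by simp
qed

lemma increment_distributed:
  assumes "0 \<le> s" "s < t" "t \<le> T"
  shows "distributed M lborel (\<lambda>\<omega>. W t \<omega> - W s \<omega>)
    (\<lambda>x. ennreal (normal_density 0 (sqrt (t - s)) x))"
  using brownian assms by (auto simp: standard_brownian_motion_def)

lemma prob_past_and_increment:
  assumes "0 \<le> s" "s < t" "t \<le> T" and A: "A \<in> sets (F s)" and B: "B \<in> sets borel"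
  shows "prob {\<omega> \<in> A. W t \<omega> - W s \<omega> \<in> B}
    = prob A * prob {\<omega> \<in> space M. W t \<omega> - W s \<omega> \<in> B}"
proof -
  let ?D = "\<lambda>\<omega>. W t \<omega> - W s \<omega>"
  have "indep_set (sets (F s)) (sets (vimage_algebra (space M) ?D borel))"
    using brownian assms by (auto simp: standard_brownian_motion_def)
  from indep_setD[OF this A in_vimage_algebra[OF B]]
  have "prob (A \<inter> (?D -` B \<inter> space M)) = prob A * prob (?D -` B \<inter> space M)" .
  moreover have "A \<subseteq> space M"
    using A subalgebra_F[of s] assms sets.sets_into_space[of A M] by (auto simp: subalgebra_def)
  then have "A \<inter> (?D -` B \<inter> space M) = {\<omega> \<in> A. ?D \<omega> \<in> B}" by auto
  moreover have "?D -` B \<inter> space M = {\<omega> \<in> space M. ?D \<omega> \<in> B}" by auto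
  ultimately show ?thesis by simp
qed

text \<open>
  Only the independence of one increment from the past is available, so the event is built one
  step at a time: the part fixed up to the grid point \<open>n * h\<close> belongs to the past of the
  next increment. Measurability with respect to the filtration therefore has to be carried
  through the same induction as the product formula.
\<close>

lemma prob_grid_increments:
  fixes h :: real and B :: "nat \<Rightarrow> real set"
  assumes "0 < h" and A: "A \<in> sets (F 0)" and B: "\<And>k. B k \<in> sets borel"
  defines "D \<equiv> \<lambda>k \<omega>. W (real (Suc k) * h) \<omega> - W (real k * h) \<omega>"
  assumes "real n * h \<le> T"
  shows "{\<omega> \<in> A. \<forall>k<n. D k \<omega> \<in> B k} \<in> sets (F (real n * h))"
    and "prob {\<omega> \<in> A. \<forall>k<n. D k \<omega> \<in> B k}
      = prob A * (\<Prod>k<n. prob {\<omega> \<in> space M. D k \<omega> \<in> B k})"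
proof -
  have "{\<omega> \<in> A. \<forall>k<n. D k \<omega> \<in> B k} \<in> sets (F (real n * h)) \<and>
    prob {\<omega> \<in> A. \<forall>k<n. D k \<omega> \<in> B k}
      = prob A * (\<Prod>k<n. prob {\<omega> \<in> space M. D k \<omega> \<in> B k})"
    using \<open>real n * h \<le> T\<close>
  proof (induction n)
    case 0
    then show ?case using A by simp
  next
    case (Suc n)
    let ?s = "real n * h" and ?t = "real (Suc n) * h"
    let ?E = "{\<omega> \<in> A. \<forall>k<n. D k \<omega> \<in> B k}"
    have st: "0 \<le> ?s" "?s < ?t" "?t \<le> T"
      using Suc.prems \<open>0 < h\<close> by (simp_all add: distrib_right)
    then have "?s \<le> T" by linarith
    from Suc.IH[OF this] have IH: "?E \<in> sets (F ?s)"
        "prob ?E = prob A * (\<Prod>k<n. prob {\<omega> \<in> space M. D k \<omega> \<in> B k})"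
      by blast+
    have E: "{\<omega> \<in> A. \<forall>k<Suc n. D k \<omega> \<in> B k} = {\<omega> \<in> ?E. D n \<omega> \<in> B n}"
      by (auto simp: less_Suc_eq)
    have sub: "subalgebra (F ?t) (F ?s)" using st by (intro subalgebra_F_mono) auto
    have Et: "?E \<in> sets (F ?t)" using IH(1) sub unfolding subalgebra_def by blast
    have Dt: "D n \<in> borel_measurable (F ?t)"
      unfolding D_def using st by (intro increment_measurable) auto
    have "{\<omega> \<in> ?E. D n \<omega> \<in> B n} = ?E \<inter> (D n -` B n \<inter> space (F ?t))"
      using sets.sets_into_space[OF Et] by blast
    with sets.Int[OF Et measurable_sets[OF Dt B]]
    have 1: "{\<omega> \<in> ?E. D n \<omega> \<in> B n} \<in> sets (F ?t)" by (simp only:)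
    have 2: "prob {\<omega> \<in> ?E. D n \<omega> \<in> B n} = prob ?E * prob {\<omega> \<in> space M. D n \<omega> \<in> B n}"
      unfolding D_def by (rule prob_past_and_increment[OF st IH(1)[unfolded D_def] B])
    have "prob {\<omega> \<in> ?E. D n \<omega> \<in> B n} = prob A * (\<Prod>k<Suc n. prob {\<omega> \<in> space M. D k \<omega> \<in> B k})"
      unfolding 2 IH(2) prod.lessThan_Suc by (rule mult.assoc)
    with 1 show ?case unfolding E by blast
  qed
  then show "{\<omega> \<in> A. \<forall>k<n. D k \<omega> \<in> B k} \<in> sets (F (real n * h))"
    and "prob {\<omega> \<in> A. \<forall>k<n. D k \<omega> \<in> B k}
      = prob A * (\<Prod>k<n. prob {\<omega> \<in> space M. D k \<omega> \<in> B k})"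
    by blast+
qed

text \<open>
  The section at time \<open>T\<close> of a generator \<open>{s<..t} \<times> A\<close> of the predictable algebra is \<open>A\<close> if
  \<open>t = T\<close> and empty otherwise.
\<close>

lemma predictable_process_measurable_end:
  assumes "predictable_process M T F X"
  shows "X T \<in> borel_measurable M"
proof -
  have F: "A \<in> sets M" if "A \<in> sets (F s)" "0 \<le> s" "s \<le> T" for A s
    using that subalgebra_F[of s] by (auto simp: subalgebra_def)
  have "(\<lambda>\<omega>. (T, \<omega>)) \<in> measurable M (predictable_algebra M T F)"
    unfolding predictable_algebra_def
  proof (rule measurable_measure_of)
    show "{{0} \<times> A |A. A \<in> sets (F 0)} \<union>
        {{s<..t} \<times> A |s t A. 0 \<le> s \<and> s < t \<and> t \<le> T \<and> A \<in> sets (F s)} \<subseteq> Pow ({0..T} \<times> space M)"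
    proof
      fix S assume "S \<in> {{0} \<times> A |A. A \<in> sets (F 0)} \<union>
        {{s<..t} \<times> A |s t A. 0 \<le> s \<and> s < t \<and> t \<le> T \<and> A \<in> sets (F s)}"
      then consider A where "S = {0} \<times> A" "A \<in> sets (F 0)"
        | s t A where "S = {s<..t} \<times> A" "0 \<le> s" "s < t" "t \<le> T" "A \<in> sets (F s)"
        by blast
      then show "S \<in> Pow ({0..T} \<times> space M)"
      proof cases
        case 1
        then have "A \<subseteq> space M" using T_pos by (intro sets.sets_into_space F[of A 0]) auto
        then show ?thesis using 1(1) T_pos by auto
      next
        case 2
        then have "A \<subseteq> space M" by (intro sets.sets_into_space F[of A s]) auto
        then show ?thesis using 2(1-4) by auto
      qed
    qed
  next
    fix S assume "S \<in> {{0} \<times> A |A. A \<in> sets (F 0)} \<union>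
        {{s<..t} \<times> A |s t A. 0 \<le> s \<and> s < t \<and> t \<le> T \<and> A \<in> sets (F s)}"
    then consider A where "S = {0} \<times> A"
      | s t A where "S = {s<..t} \<times> A" "0 \<le> s" "s < t" "t \<le> T" "A \<in> sets (F s)"
      by blast
    then show "(\<lambda>\<omega>. (T, \<omega>)) -` S \<inter> space M \<in> sets M"
    proof cases
      case 1
      then have "(\<lambda>\<omega>. (T, \<omega>)) -` S \<inter> space M = {}" using T_pos by auto
      then show ?thesis by simp
    next
      case 2
      then have "(\<lambda>\<omega>. (T, \<omega>)) -` S \<inter> space M = (if t = T then A \<inter> space M else {})"
        by auto
      then show ?thesis using F[of A s] 2 by auto
    qed
  qed (use T_pos in auto)
  from measurable_compose[OF this assms[unfolded predictable_process_def]]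
  show ?thesis by simp
qed

lemma euler_approx_measurable:
  assumes "\<xi> \<in> borel_measurable (F 0)" "\<mu> \<in> borel_measurable borel" "\<sigma> \<in> borel_measurable borel"
    and "N \<ge> 1" "n \<le> N"
  shows "euler_approx T W \<xi> \<mu> \<sigma> N n \<in> borel_measurable M"
  using \<open>n \<le> N\<close>
proof (induction n)
  case 0
  have "\<xi> \<in> borel_measurable M"
    using assms(1) T_pos by (intro measurable_from_subalg[OF subalgebra_F[of 0]]) auto
  then show ?case by simp
next
  case (Suc n)
  have t: "0 \<le> real n * T / real N" "real n * T / real N \<le> real (Suc n) * T / real N"
      "real (Suc n) * T / real N \<le> T"
    using Suc.prems T_pos \<open>N \<ge> 1\<close>
    by (auto simp: field_simps mult_left_mono simp flip: of_nat_Suc)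
  have [measurable]: "(\<lambda>\<omega>. W (real (Suc n) * T / real N) \<omega> - W (real n * T / real N) \<omega>)
      \<in> borel_measurable M"
    using t by (intro measurable_from_subalg[OF subalgebra_F increment_measurable]) auto
  note [measurable] = assms(2,3)
  have [measurable]: "euler_approx T W \<xi> \<mu> \<sigma> N n \<in> borel_measurable M"
    using Suc by simp
  show ?case unfolding euler_approx.simps by measurable
qed

end

section \<open>Probability and size of the excursion\<close>

text \<open>
  The event \<open>\<sigma> (\<xi> \<omega>) \<noteq> 0\<close> is the countable union over \<open>K\<close> of the events considered here, so they
  cannot all be null sets.
\<close>

lemma (in prob_space) tame_start_positive_prob:
  fixes \<xi> :: "'a \<Rightarrow> real" and \<mu> \<sigma> :: "real \<Rightarrow> real"
  assumes [measurable]: "\<xi> \<in> borel_measurable M" "\<mu> \<in> borel_measurable borel"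
      "\<sigma> \<in> borel_measurable borel"
    and pos: "prob {\<omega> \<in> space M. \<sigma> (\<xi> \<omega>) \<noteq> 0} > 0"
  shows "\<exists>K>0. prob {\<omega> \<in> space M. abs (\<xi> \<omega>) + T * abs (\<mu> (\<xi> \<omega>)) \<le> K \<and> 1 / K \<le> abs (\<sigma> (\<xi> \<omega>))} > 0"
proof (rule ccontr)
  define E where "E K = {\<omega> \<in> space M. abs (\<xi> \<omega>) + T * abs (\<mu> (\<xi> \<omega>)) \<le> K \<and> 1 / K \<le> abs (\<sigma> (\<xi> \<omega>))}"
    for K
  have [measurable]: "E K \<in> sets M" for K unfolding E_def by measurable
  assume "\<not> ?thesis"
  then have "\<not> 0 < prob (E K)" if "K > 0" for K
    using that unfolding E_def by blast
  then have "prob (E K) = 0" if "K > 0" for K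
    using that by (simp add: zero_less_measure_iff)
  then have "(\<Union>n. E (real (Suc n))) \<in> null_sets M"
    by (intro null_sets_UN) (auto simp: null_sets_def emeasure_eq_measure)
  moreover have "{\<omega> \<in> space M. \<sigma> (\<xi> \<omega>) \<noteq> 0} \<subseteq> (\<Union>n. E (real (Suc n)))"
  proof
    fix \<omega> assume \<omega>: "\<omega> \<in> {\<omega> \<in> space M. \<sigma> (\<xi> \<omega>) \<noteq> 0}"
    obtain n where n: "max (abs (\<xi> \<omega>) + T * abs (\<mu> (\<xi> \<omega>))) (1 / abs (\<sigma> (\<xi> \<omega>))) \<le> real n"
      using real_arch_simple by blast
    then have "1 / abs (\<sigma> (\<xi> \<omega>)) \<le> real (Suc n)" by auto
    then have "1 / real (Suc n) \<le> abs (\<sigma> (\<xi> \<omega>))" using \<omega> by (simp add: field_simps)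
    then have "\<omega> \<in> E (real (Suc n))" using \<omega> n by (auto simp: E_def)
    then show "\<omega> \<in> (\<Union>n. E (real (Suc n)))" by blast
  qed
  moreover have "{\<omega> \<in> space M. \<sigma> (\<xi> \<omega>) \<noteq> 0} \<in> sets M" by measurable
  ultimately have "{\<omega> \<in> space M. \<sigma> (\<xi> \<omega>) \<noteq> 0} \<in> null_sets M"
    using null_sets_subset by blast
  then show False using pos by (simp add: null_sets_def emeasure_eq_measure)
qed

text \<open>
  The first increment makes \<open>\<sigma> (\<xi> \<omega>) * D 0\<close> so large that the first step reaches
  the threshold \<open>r\<close>. From then on \<open>euler_step_superlinear\<close> applies to every step, since its
  conclusion keeps the scheme above \<open>r\<close>; iterating \<open>N - 1\<close> times turns \<open>r\<close> into
  \<open>r powr (\<alpha> ^ (N - 1))\<close>.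
\<close>

lemma euler_doubly_exponential_growth:
  fixes T C \<alpha> \<beta> r K :: real and N :: nat
    and W :: "real \<Rightarrow> 'a \<Rightarrow> real" and \<xi> :: "'a \<Rightarrow> real" and \<omega> :: 'a
  defines "h \<equiv> T / real N"
  defines "D \<equiv> \<lambda>k. W (real (Suc k) * T / real N) \<omega> - W (real k * T / real N) \<omega>"
  assumes "0 < T" "N \<ge> 1" "0 < C" "1 \<le> \<alpha>" "\<alpha> < \<beta>" "0 < K"
    and large: "\<And>x. C \<le> abs x \<Longrightarrow> max (abs (\<mu> x)) (abs (\<sigma> x)) \<ge> abs x powr \<beta> / C"
    and small: "\<And>x. C \<le> abs x \<Longrightarrow> min (abs (\<mu> x)) (abs (\<sigma> x)) \<le> C * abs x powr \<alpha>"
    and r: "2 \<le> r" "C \<le> r" "C * (2 / h + 2 * C) \<le> r powr (\<beta> - \<alpha>)"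
    and start: "abs (\<xi> \<omega>) + T * abs (\<mu> (\<xi> \<omega>)) \<le> K" "1 / K \<le> abs (\<sigma> (\<xi> \<omega>))"
    and D0: "K * (r + K) \<le> D 0" and D: "\<And>k. 1 \<le> k \<Longrightarrow> k < N \<Longrightarrow> D k \<in> {h..2 * h}"
  shows "2 powr (\<alpha> ^ (N - 1)) \<le> abs (euler_approx T W \<xi> \<mu> \<sigma> N N \<omega>)"
proof -
  let ?Y = "\<lambda>n. euler_approx T W \<xi> \<mu> \<sigma> N n \<omega>"
  have h: "0 < h" "h \<le> T"
    using assms(3,4) by (auto simp: h_def field_simps)
  have step: "?Y (Suc n) = ?Y n + h * \<mu> (?Y n) + \<sigma> (?Y n) * D n" for n
    by (simp add: h_def D_def)
  have "r powr (\<alpha> ^ n) \<le> abs (?Y (Suc n))" if "Suc n \<le> N" for n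
    using that
  proof (induction n)
    case 0
    have "h * abs (\<mu> (\<xi> \<omega>)) \<le> T * abs (\<mu> (\<xi> \<omega>))" using h by (intro mult_right_mono) auto
    then have a: "abs (\<xi> \<omega> + h * \<mu> (\<xi> \<omega>)) \<le> K"
      using start(1) h(1) abs_triangle_ineq[of "\<xi> \<omega>" "h * \<mu> (\<xi> \<omega>)"] by (simp add: abs_mult)
    have "(1 / K) * (K * (r + K)) \<le> abs (\<sigma> (\<xi> \<omega>)) * abs (D 0)"
      using start(2) D0 \<open>0 < K\<close> r by (intro mult_mono) auto
    then have "r + K \<le> abs (\<sigma> (\<xi> \<omega>) * D 0)"
      using \<open>0 < K\<close> by (simp add: abs_mult)
    then show ?case using a step[of 0] r by (simp del: euler_approx.simps(2))
  next
    case (Suc n)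
    let ?y = "?Y (Suc n)"
    have IH: "r powr (\<alpha> ^ n) \<le> abs ?y" using Suc by simp
    have "r powr 1 \<le> r powr (\<alpha> ^ n)"
      using r \<open>1 \<le> \<alpha>\<close> by (intro powr_mono) (auto simp: one_le_power)
    then have ry: "r \<le> abs ?y" using IH r by simp
    have Dn: "h \<le> abs (D (Suc n))" "abs (D (Suc n)) \<le> 2 * h"
      using D[of "Suc n"] Suc.prems h by auto
    have "C * (2 / h + 2 * C) \<le> abs ?y powr (\<beta> - \<alpha>)"
      using r(1) ry \<open>\<alpha> < \<beta>\<close> by (intro order_trans[OF r(3)] powr_mono2) auto
    moreover have "C \<le> abs ?y" "1 \<le> abs ?y" using ry r by linarith+
    ultimately have "abs ?y powr \<alpha> \<le> abs (?Y (Suc (Suc n)))"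
      unfolding step[of "Suc n"]
      by (intro euler_step_superlinear[OF large small \<open>0 < C\<close> h(1) \<open>1 \<le> \<alpha>\<close> _ _ Dn])
    moreover have "(r powr (\<alpha> ^ n)) powr \<alpha> \<le> abs ?y powr \<alpha>"
      using IH \<open>1 \<le> \<alpha>\<close> by (intro powr_mono2) auto
    ultimately show ?case by (simp add: powr_powr mult.commute del: euler_approx.simps(2))
  qed
  from this[of "N - 1"] have "r powr (\<alpha> ^ (N - 1)) \<le> abs (?Y N)"
    using \<open>N \<ge> 1\<close> by simp
  moreover have "2 powr (\<alpha> ^ (N - 1)) \<le> r powr (\<alpha> ^ (N - 1))"
    using r \<open>1 \<le> \<alpha>\<close> by (intro powr_mono2) auto
  ultimately show ?thesis by linarith
qed

lemma normal_density_sqrt_ge: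
  assumes "0 < h" "h \<le> T"
  shows "exp (- b\<^sup>2 / (2 * h)) / sqrt (2 * pi * T) \<le> normal_density 0 (sqrt h) b"
  using assms unfolding normal_density_def
  by (auto simp: divide_simps mult_left_mono)

context filtered_brownian_motion
begin

text \<open>
  With \<open>h = T / N\<close>, the density bound at the right end of each interval gives, up to a constant
  factor, \<open>exp (- (a N + 1)\<^sup>2 / (2 * h))\<close> for the first increment and \<open>1 / N\<close> for every later
  one. The exponent of the former is of order \<open>N powr (2 * q + 1)\<close>. The latter is replaced by
  the cruder \<open>exp (- N)\<close>, whose \<open>N\<close>-th power has an exponent of order \<open>N\<^sup>2\<close>. All contributions are
  absorbed by \<open>N powr (2 * q + 2)\<close>.
\<close>

lemma excursion_event_prob_ge:
  fixes a :: "nat \<Rightarrow> real" and q G :: real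
  assumes A: "A \<in> sets (F 0)" "0 < prob A"
    and a: "\<And>N. N \<ge> 1 \<Longrightarrow> 0 \<le> a N" "\<And>N. N \<ge> 1 \<Longrightarrow> a N + 1 \<le> G * real N powr q"
    and "0 \<le> q"
  defines "B \<equiv> \<lambda>N k. if k = 0 then {a N..a N + 1} else {T / real N..2 * (T / real N)}"
  defines "E \<equiv> \<lambda>N. {\<omega> \<in> A. \<forall>k<N.
      W (real (Suc k) * T / real N) \<omega> - W (real k * T / real N) \<omega> \<in> B N k}"
  shows "\<exists>L\<ge>0. \<forall>N\<ge>1. E N \<in> sets M \<and> exp (- L * real N powr (2 * q + 2)) \<le> prob (E N)"
proof -
  \<comment> \<open>A single \<open>\<kappa>\<close> serves as the constant factor for the first and for the later increments.\<close>
  define S where "S = sqrt (2 * pi * T)"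
  define \<kappa> where "\<kappa> = min 1 (min (1 / S) (T * exp (- 2 * T) / S))"
  define J where "J = G\<^sup>2 / (2 * T)"
  have S: "S > 0" using T_pos by (simp add: S_def)
  have \<kappa>: "0 < \<kappa>" "\<kappa> \<le> 1" "\<kappa> \<le> 1 / S" "\<kappa> \<le> T * exp (- 2 * T) / S"
    using S T_pos by (auto simp: \<kappa>_def)
  have J: "J \<ge> 0" using T_pos by (simp add: J_def)
  define L where "L = 1 + J - ln \<kappa> - ln (prob A)"
  have lnA: "ln (prob A) \<le> 0" and ln\<kappa>: "ln \<kappa> \<le> 0" using A \<kappa> by auto
  have "E N \<in> sets M \<and> exp (- L * real N powr (2 * q + 2)) \<le> prob (E N)" if N: "N \<ge> 1" for N
  proof -
    define h where "h = T / real N"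
    have h: "0 < h" "h \<le> T" "real N * h = T"
      using N T_pos by (auto simp: h_def field_simps)
    define D where "D k \<omega> = W (real (Suc k) * h) \<omega> - W (real k * h) \<omega>" for k \<omega>
    define pr where "pr k = prob {\<omega> \<in> space M. D k \<omega> \<in> B N k}" for k
    have E: "E N = {\<omega> \<in> A. \<forall>k<N. D k \<omega> \<in> B N k}"
      by (simp add: E_def D_def h_def)
    have B: "B N k \<in> sets borel" for k by (simp add: B_def)
    have grid: "real N * h \<le> T" using h by simp
    note EF = prob_grid_increments[OF h(1) A(1) B grid, folded D_def]
    have EM: "E N \<in> sets M"
    proof -
      have "sets (F (real N * h)) \<subseteq> sets M"
        using subalgebra_F[of T] T_pos unfolding h(3) subalgebra_def by simp
      then show ?thesis unfolding E by (rule subsetD[OF _ EF(1)])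
    qed
    have dist: "distributed M lborel (D k) (\<lambda>x. ennreal (normal_density 0 (sqrt h) x))"
      if "k < N" for k
    proof -
      have "real (Suc k) * h \<le> real N * h" using that h by (intro mult_right_mono) auto
      then show ?thesis
        using increment_distributed[of "real k * h" "real (Suc k) * h"] h
        by (simp add: D_def[abs_def] algebra_simps)
    qed
    have first: "\<kappa> * exp (- (J * real N powr (2 * q + 1))) \<le> pr 0"
    proof -
      have "(a N + 1)\<^sup>2 \<le> (G * real N powr q)\<^sup>2"
        using a[OF N] by (intro power_mono) auto
      also have "\<dots> = G\<^sup>2 * real N powr (2 * q)"
        by (simp only: power_mult_distrib power2_eq_square[of "real N powr q"] mult_2 powr_add)
      finally have "(a N + 1)\<^sup>2 / (2 * h) \<le> G\<^sup>2 * real N powr (2 * q) / (2 * h)"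
        using h by (intro divide_right_mono) auto
      also have "\<dots> = J * real N powr (2 * q + 1)"
        using N T_pos by (simp add: J_def h_def powr_add field_simps)
      finally have "exp (- (J * real N powr (2 * q + 1))) / S \<le> exp (- (a N + 1)\<^sup>2 / (2 * h)) / S"
        using S by (intro divide_right_mono) auto
      also have "\<dots> \<le> normal_density 0 (sqrt h) (a N + 1)"
        unfolding S_def by (intro normal_density_sqrt_ge h)
      also have "\<dots> \<le> pr 0"
        using normal_prob_interval_ge[OF dist[of 0], of "a N" "a N + 1"] N h a(1)[OF N]
        by (simp add: pr_def B_def)
      finally have 1: "exp (- (J * real N powr (2 * q + 1))) / S \<le> pr 0" .
      have "\<kappa> * exp (- (J * real N powr (2 * q + 1)))
          \<le> (1 / S) * exp (- (J * real N powr (2 * q + 1)))"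
        by (intro mult_right_mono \<kappa>) auto
      with 1 show ?thesis by simp
    qed
    have later: "\<kappa> * exp (- real N) \<le> pr k" if k: "0 < k" "k < N" for k
    proof -
      have "real N \<le> exp (real N)" using exp_ge_add_one_self[of "real N"] by linarith
      then have "exp (- real N) \<le> 1 / real N" using N by (simp add: exp_minus field_simps)
      then have "\<kappa> * exp (- real N) \<le> (T * exp (- 2 * T) / S) * (1 / real N)"
        using \<kappa> by (intro mult_mono) auto
      also have "\<dots> = h * (exp (- 2 * T) / S)" by (simp add: h_def)
      also have "\<dots> \<le> h * (exp (- (2 * h)\<^sup>2 / (2 * h)) / S)"
        using h S by (intro mult_left_mono divide_right_mono) (auto simp: power2_eq_square)
      also have "\<dots> \<le> h * normal_density 0 (sqrt h) (2 * h)"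
        unfolding S_def using h by (intro mult_left_mono normal_density_sqrt_ge) auto
      also have "\<dots> \<le> pr k"
        using normal_prob_interval_ge[OF dist[OF k(2)], of h "2 * h"] h k
        by (simp add: pr_def B_def h_def)
      finally show ?thesis .
    qed
    define e where "e = exp (- (J * real N powr (2 * q + 1)))"
    have e: "0 < e" "e \<le> 1" using J by (auto simp: e_def)
    have "(\<Prod>k<N. (\<kappa> * exp (- real N)) * (if k = 0 then e else 1)) \<le> (\<Prod>k<N. pr k)"
    proof (rule prod_mono, safe)
      fix k assume "k < N"
      show "0 \<le> \<kappa> * exp (- real N) * (if k = 0 then e else 1)" using \<kappa> e by auto
      show "\<kappa> * exp (- real N) * (if k = 0 then e else 1) \<le> pr k"
      proof (cases "k = 0")
        case True
        have "\<kappa> * exp (- real N) * e \<le> \<kappa> * 1 * e"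
          using \<kappa> e by (intro mult_right_mono mult_left_mono) auto
        then show ?thesis using first True unfolding e_def[symmetric] by simp
      qed (use later[of k] \<open>k < N\<close> in auto)
    qed
    moreover have "(\<Prod>k<N. (\<kappa> * exp (- real N)) * (if k = 0 then e else 1))
        = (\<kappa> * exp (- real N)) ^ N * e"
      using N by (simp add: prod.distrib prod.delta del: power_mult_distrib)
    ultimately have "prob A * ((\<kappa> * exp (- real N)) ^ N * e) \<le> prob (E N)"
      using EF(2) by (simp add: E pr_def mult_left_mono)
    moreover have "prob A * ((\<kappa> * exp (- real N)) ^ N * e)
        = exp (ln (prob A) + (real N * (ln \<kappa> - real N) - J * real N powr (2 * q + 1)))"
    proof -
      have "\<kappa> * exp (- real N) = exp (ln \<kappa> - real N)"
        using \<kappa> by (simp add: exp_diff exp_minus field_simps)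
      then have "(\<kappa> * exp (- real N)) ^ N = exp (real N * (ln \<kappa> - real N))"
        by (simp add: exp_of_nat_mult)
      then show ?thesis using A(2) by (simp add: e_def exp_add exp_diff exp_minus field_simps)
    qed
    moreover have "- L * real N powr (2 * q + 2)
        \<le> ln (prob A) + (real N * (ln \<kappa> - real N) - J * real N powr (2 * q + 1))"
    proof -
      define Z where "Z = real N powr (2 * q + 2)"
      have Z: "x powr y \<le> Z" if "x = real N" "y \<le> 2 * q + 2" for x y
        unfolding Z_def that(1) using that N by (intro powr_mono) auto
      have Z0: "1 \<le> Z" using Z[of "real N" 0] N \<open>0 \<le> q\<close> by simp
      have Z1: "real N \<le> Z" using Z[of "real N" 1] N \<open>0 \<le> q\<close> by simp
      have Z2: "real N * real N \<le> Z"
        using Z[of "real N" 2] N \<open>0 \<le> q\<close> by (simp add: powr_numeral power2_eq_square)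
      have 1: "J * real N powr (2 * q + 1) \<le> J * Z" using J Z by (intro mult_left_mono) auto
      have 2: "ln (prob A) * Z \<le> ln (prob A)"
        using mult_left_mono_neg[OF Z0 lnA] by simp
      have 3: "ln \<kappa> * Z \<le> ln \<kappa> * real N"
        using mult_left_mono_neg[OF Z1 ln\<kappa>] by simp
      have "- L * Z = ln (prob A) * Z + ln \<kappa> * Z - Z - J * Z"
        by (simp add: L_def algebra_simps)
      also have "\<dots> \<le> ln (prob A) + ln \<kappa> * real N - real N * real N - J * real N powr (2 * q + 1)"
        using 1 2 3 Z2 by linarith
      finally show ?thesis by (simp add: Z_def algebra_simps)
    qed
    ultimately have "exp (- L * real N powr (2 * q + 2)) \<le> prob (E N)"
      by (smt (verit) exp_le_cancel_iff)
    with EM show ?thesis by simp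
  qed
  moreover have "L \<ge> 0" using J lnA ln\<kappa> by (simp add: L_def)
  ultimately show ?thesis by blast
qed

end

text \<open>
  The same constant serves as base and as exponent; it suffices that it exceeds both \<open>exp L\<close>
  and the degree \<open>m\<close>.
\<close>

lemma exp_poly_bound_as_single_constant:
  fixes L m :: real
  assumes "0 \<le> L"
  shows "\<exists>c>1. \<forall>N\<ge>1. c powr (- (real N powr c)) \<le> exp (- L * real N powr m)"
proof -
  define c where "c = max 2 (max m (exp L))"
  have c: "c > 1" "m \<le> c" by (auto simp: c_def)
  have "exp L \<le> c" by (simp add: c_def)
  then have lnc: "L \<le> ln c" using c by (simp add: ln_ge_iff)
  have "c powr (- (real N powr c)) \<le> exp (- L * real N powr m)" if "N \<ge> 1" for N
  proof -
    have "L * real N powr m \<le> ln c * real N powr c"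
      using assms lnc c that by (intro mult_mono powr_mono) auto
    then show ?thesis using c by (simp add: powr_def mult.commute)
  qed
  with c(1) show ?thesis by blast
qed

section \<open>From the excursion to the moments\<close>

lemma doubly_exponential_beats_exp_poly:
  fixes \<alpha> L m :: real
  assumes "\<alpha> > 1"
  shows "filterlim (\<lambda>N. 2 powr (\<alpha> ^ (N - 1)) * exp (- L * real N powr m)) at_top sequentially"
proof -
  have "filterlim (\<lambda>n. ln 2 * \<alpha> ^ n - L * real (Suc n) powr m) at_top sequentially"
    using assms by real_asymp
  then have "filterlim (\<lambda>n. exp (ln 2 * \<alpha> ^ n - L * real (Suc n) powr m)) at_top sequentially"
    by (rule filterlim_compose[OF exp_at_top])
  moreover have "exp (ln 2 * \<alpha> ^ n - L * real (Suc n) powr m)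
      = 2 powr (\<alpha> ^ (Suc n - 1)) * exp (- L * real (Suc n) powr m)" for n
    by (simp add: powr_def exp_diff exp_minus field_simps)
  ultimately show ?thesis
    by (subst filterlim_sequentially_Suc[symmetric]) simp
qed

lemma ennreal_tendsto_top_transfer:
  fixes y b :: "nat \<Rightarrow> ennreal"
  assumes "y \<longlonglongrightarrow> \<infinity>" and le: "\<And>n. n \<ge> 1 \<Longrightarrow> y n \<le> ennreal k * (x + b n)" and "x < \<infinity>"
  shows "b \<longlonglongrightarrow> \<infinity>"
  unfolding infinity_ennreal_def tendsto_top_iff_ennreal
proof (intro allI impI)
  fix l :: real
  have "ennreal k * (x + ennreal l) < \<infinity>"
    using \<open>x < \<infinity>\<close> by (simp add: ennreal_mult_less_top)
  from order_tendstoD(1)[OF assms(1) this]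
  show "\<forall>\<^sub>F n in sequentially. ennreal l < b n"
    using eventually_ge_at_top[of 1]
  proof eventually_elim
    case (elim n)
    show ?case
    proof (rule ccontr)
      assume "\<not> ennreal l < b n"
      then have "ennreal k * (x + b n) \<le> ennreal k * (x + ennreal l)"
        by (intro mult_left_mono add_left_mono) auto
      with le[OF elim(2)] elim(1) show False by (meson leD order_trans)
    qed
  qed
qed

lemma powr_abs_le_sum:
  fixes x y p :: real
  assumes "0 \<le> p"
  shows "\<bar>y\<bar> powr p \<le> 2 powr p * (\<bar>x\<bar> powr p + \<bar>x - y\<bar> powr p)"
proof -
  have "\<bar>y\<bar> powr p \<le> (2 * max \<bar>x\<bar> \<bar>x - y\<bar>) powr p"
    using assms by (intro powr_mono2) (simp_all add: max_def abs_if)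
  also have "\<dots> = 2 powr p * max \<bar>x\<bar> \<bar>x - y\<bar> powr p" by (simp add: powr_mult)
  also have "\<dots> \<le> 2 powr p * (\<bar>x\<bar> powr p + \<bar>x - y\<bar> powr p)"
    by (intro mult_left_mono) (auto simp: max_def)
  finally show ?thesis .
qed

text \<open>
  The \<open>p\<close>-th absolute moment of \<open>Y N\<close> is bounded below by the contribution of \<open>\<Omega> N\<close>, where
  \<open>\<bar>Y N \<omega>\<bar> powr p \<ge> \<bar>Y N \<omega>\<bar>\<close>, so it tends to infinity. The finite moment of \<open>Z\<close> cannot
  compensate this, neither in the inequality \<open>powr_abs_le_sum\<close> nor in the difference of the
  moments; the latter is formed in the extended reals, where the moment of \<open>Y N\<close> may be \<open>\<infinity>\<close>.
\<close>

lemma (in prob_space) moments_diverge: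
  fixes Z :: "'a \<Rightarrow> real" and Y :: "nat \<Rightarrow> 'a \<Rightarrow> real" and v :: "nat \<Rightarrow> real"
  assumes [measurable]: "Z \<in> borel_measurable M"
    and Y: "\<And>N. N \<ge> 1 \<Longrightarrow> Y N \<in> borel_measurable M"
    and \<Omega>: "\<And>N. N \<ge> 1 \<Longrightarrow> \<Omega> N \<in> sets M"
    and large: "\<And>N \<omega>. N \<ge> 1 \<Longrightarrow> \<omega> \<in> \<Omega> N \<Longrightarrow> v N \<le> \<bar>Y N \<omega>\<bar>" and v: "\<And>N. 1 \<le> v N"
    and lim: "filterlim (\<lambda>N. v N * prob (\<Omega> N)) at_top sequentially"
    and "1 \<le> p" and fin: "(\<integral>\<^sup>+\<omega>. ennreal (\<bar>Z \<omega>\<bar> powr p) \<partial>M) < \<infinity>"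
  shows "(\<lambda>N. \<integral>\<^sup>+\<omega>. ennreal (\<bar>Z \<omega> - Y N \<omega>\<bar> powr p) \<partial>M) \<longlonglongrightarrow> \<infinity>"
    and "(\<lambda>N. \<bar>enn2ereal (\<integral>\<^sup>+\<omega>. ennreal (\<bar>Z \<omega>\<bar> powr p) \<partial>M)
             - enn2ereal (\<integral>\<^sup>+\<omega>. ennreal (\<bar>Y N \<omega>\<bar> powr p) \<partial>M)\<bar>) \<longlonglongrightarrow> \<infinity>"
proof -
  let ?x = "\<integral>\<^sup>+\<omega>. ennreal (\<bar>Z \<omega>\<bar> powr p) \<partial>M"
  let ?y = "\<lambda>N. \<integral>\<^sup>+\<omega>. ennreal (\<bar>Y N \<omega>\<bar> powr p) \<partial>M"
  let ?b = "\<lambda>N. \<integral>\<^sup>+\<omega>. ennreal (\<bar>Z \<omega> - Y N \<omega>\<bar> powr p) \<partial>M"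
  have low: "ennreal (v N * prob (\<Omega> N)) \<le> ?y N" if N: "N \<ge> 1" for N
  proof -
    have "ennreal (v N * prob (\<Omega> N)) = (\<integral>\<^sup>+\<omega>. ennreal (v N) * indicator (\<Omega> N) \<omega> \<partial>M)"
      using \<Omega>[OF N] v[of N]
      by (simp add: nn_integral_cmult_indicator ennreal_mult' emeasure_eq_measure)
    also have "\<dots> \<le> ?y N"
    proof (intro nn_integral_mono)
      fix \<omega>
      have "v N \<le> \<bar>Y N \<omega>\<bar> powr p" if "\<omega> \<in> \<Omega> N"
        using large[OF N that] v[of N] powr_mono[of 1 p "\<bar>Y N \<omega>\<bar>"] \<open>1 \<le> p\<close> by simp
      then show "ennreal (v N) * indicator (\<Omega> N) \<omega> \<le> ennreal (\<bar>Y N \<omega>\<bar> powr p)"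
        by (auto simp: indicator_def intro: ennreal_leI)
    qed
    finally show ?thesis .
  qed
  have "(\<lambda>N. ennreal (v N * prob (\<Omega> N))) \<longlonglongrightarrow> \<infinity>"
    using lim by (simp add: ennreal_tendsto_top_eq_at_top infinity_ennreal_def)
  then have ylim: "?y \<longlonglongrightarrow> \<infinity>"
    unfolding infinity_ennreal_def tendsto_top_iff_ennreal
  proof (intro allI impI)
    fix l :: real
    assume "\<forall>l\<ge>0. \<forall>\<^sub>F N in sequentially. ennreal l < ennreal (v N * prob (\<Omega> N))" and "0 \<le> l"
    then have "\<forall>\<^sub>F N in sequentially. ennreal l < ennreal (v N * prob (\<Omega> N))" by blast
    then show "\<forall>\<^sub>F N in sequentially. ennreal l < ?y N"
      using eventually_ge_at_top[of 1]
      by eventually_elim (rule less_le_trans[OF _ low])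
  qed
  have "?y N \<le> ennreal (2 powr p) * (?x + ?b N)" if N: "N \<ge> 1" for N
  proof -
    note [measurable] = Y[OF N]
    have "?y N \<le> (\<integral>\<^sup>+\<omega>. ennreal (2 powr p) *
        (ennreal (\<bar>Z \<omega>\<bar> powr p) + ennreal (\<bar>Z \<omega> - Y N \<omega>\<bar> powr p)) \<partial>M)"
      using \<open>1 \<le> p\<close>
      by (intro nn_integral_mono)
        (auto simp flip: ennreal_plus ennreal_mult' intro!: ennreal_leI powr_abs_le_sum)
    also have "\<dots> = ennreal (2 powr p) * (?x + ?b N)"
      by (simp add: nn_integral_cmult nn_integral_add)
    finally show ?thesis .
  qed
  from ennreal_tendsto_top_transfer[OF ylim this fin] show "?b \<longlonglongrightarrow> \<infinity>" by blast
  show "(\<lambda>N. \<bar>enn2ereal ?x - enn2ereal (?y N)\<bar>) \<longlonglongrightarrow> \<infinity>"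
    unfolding tendsto_PInfty'[of _ _ 0]
  proof (intro allI impI)
    fix r :: real assume r: "0 < r"
    obtain x where x: "0 \<le> x" "?x = ennreal x" using fin by (cases ?x) auto
    have "\<forall>\<^sub>F N in sequentially. ennreal (x + r) < ?y N"
      using order_tendstoD(1)[OF ylim, of "ennreal (x + r)"] by simp
    then show "\<forall>\<^sub>F N in sequentially. ereal r < \<bar>enn2ereal ?x - enn2ereal (?y N)\<bar>"
    proof eventually_elim
      case (elim N)
      show ?case
      proof (cases "?y N")
        case (real u)
        with elim x r have "x + r < u" by (simp add: ennreal_less_iff del: ennreal_plus)
        then have "r < \<bar>x - u\<bar>" by linarith
        then show ?thesis
          by (simp only: real(2) x(2)) (simp add: real(1) x(1) enn2ereal_ennreal)
      next
        case top
        show ?thesis by (simp only: top x(2)) (simp add: x(1) enn2ereal_ennreal)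
      qed
    qed
  qed
qed

theorem theorem1:
  fixes M :: "'a measure"
    and T C \<alpha> \<beta> :: real
    and F :: "real \<Rightarrow> 'a measure"
    and W X :: "real \<Rightarrow> 'a \<Rightarrow> real"
    and \<xi> :: "'a \<Rightarrow> real"
    and \<mu> \<sigma> :: "real \<Rightarrow> real"
  assumes "0 < T"
    and "prob_space M"
    and "normal_filtration M T F"
    and "standard_brownian_motion M T F W"
    and "\<xi> \<in> borel_measurable (F 0)"
    and "\<mu> \<in> borel_measurable borel"
    and "\<sigma> \<in> borel_measurable borel"
    and "predictable_process M T F X"
    and "AE \<omega> in M. (\<integral>\<^sup>+ s \<in> {0..T}. ennreal (\<bar>\<mu> (X s \<omega>)\<bar> + \<bar>\<sigma> (X s \<omega>)\<bar>\<^sup>2) \<partial>lborel) < \<infinity>"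
    and "\<forall>t\<in>{0..T}. AE \<omega> in M.
           X t \<omega> = \<xi> \<omega> + (LBINT s:{0..t}. \<mu> (X s \<omega>))
                   + ito_integral M T F W (\<lambda>s \<omega>. \<sigma> (X s \<omega>)) t \<omega>"
    and "measure M {\<omega> \<in> space M. \<sigma> (\<xi> \<omega>) \<noteq> 0} > 0"
    and "C \<ge> 1" and "\<alpha> > 1" and "\<beta> > \<alpha>"
    and "\<forall>x. \<bar>x\<bar> \<ge> C \<longrightarrow> max \<bar>\<mu> x\<bar> \<bar>\<sigma> x\<bar> \<ge> \<bar>x\<bar> powr \<beta> / C
                      \<and> min \<bar>\<mu> x\<bar> \<bar>\<sigma> x\<bar> \<le> C * \<bar>x\<bar> powr \<alpha>"
  shows "(\<exists>c>1. \<exists>\<Omega> :: nat \<Rightarrow> 'a set. \<forall>N\<ge>1.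
            \<Omega> N \<in> sets M \<and> \<Omega> N \<noteq> {} \<and>
            measure M (\<Omega> N) \<ge> c powr (- (real N powr c)) \<and>
            (\<forall>\<omega>\<in>\<Omega> N. \<bar>euler_approx T W \<xi> \<mu> \<sigma> N N \<omega>\<bar> \<ge> 2 powr (\<alpha> ^ (N - 1))))
       \<and> (\<forall>p\<ge>1. (\<integral>\<^sup>+ \<omega>. ennreal (\<bar>X T \<omega>\<bar> powr p) \<partial>M) < \<infinity> \<longrightarrow>
            ((\<lambda>N. \<integral>\<^sup>+ \<omega>. ennreal (\<bar>X T \<omega> - euler_approx T W \<xi> \<mu> \<sigma> N N \<omega>\<bar> powr p) \<partial>M)
               \<longlonglongrightarrow> \<infinity>) \<and>
            ((\<lambda>N. \<bar>enn2ereal (\<integral>\<^sup>+ \<omega>. ennreal (\<bar>X T \<omega>\<bar> powr p) \<partial>M)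
                   - enn2ereal (\<integral>\<^sup>+ \<omega>. ennreal (\<bar>euler_approx T W \<xi> \<mu> \<sigma> N N \<omega>\<bar> powr p) \<partial>M)\<bar>)
               \<longlonglongrightarrow> \<infinity>))"
proof -
  interpret prob_space M by fact
  interpret filtered_brownian_motion M T F W
    by unfold_locales fact+
  note \<xi> = \<open>\<xi> \<in> borel_measurable (F 0)\<close> and \<mu>\<sigma> = \<open>\<mu> \<in> borel_measurable borel\<close> \<open>\<sigma> \<in> borel_measurable borel\<close>
  have sub0: "subalgebra M (F 0)" using \<open>0 < T\<close> by (intro subalgebra_F) auto
  have "\<xi> \<in> borel_measurable M" using \<xi> by (rule measurable_from_subalg[OF sub0])
  then obtain K where K: "K > 0"
      "prob {\<omega> \<in> space M. abs (\<xi> \<omega>) + T * abs (\<mu> (\<xi> \<omega>)) \<le> K \<and> 1 / K \<le> abs (\<sigma> (\<xi> \<omega>))} > 0"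
    using tame_start_positive_prob[of \<xi> \<mu> \<sigma> T] \<mu>\<sigma> assms(11) by blast
  define A where "A = {\<omega> \<in> space M. abs (\<xi> \<omega>) + T * abs (\<mu> (\<xi> \<omega>)) \<le> K \<and> 1 / K \<le> abs (\<sigma> (\<xi> \<omega>))}"
  have A: "A \<in> sets (F 0)"
  proof -
    note [measurable] = \<xi> \<mu>\<sigma>
    have "A = {\<omega> \<in> space (F 0). abs (\<xi> \<omega>) + T * abs (\<mu> (\<xi> \<omega>)) \<le> K \<and> 1 / K \<le> abs (\<sigma> (\<xi> \<omega>))}"
      using sub0 by (auto simp: A_def subalgebra_def)
    then show ?thesis by simp
  qed
  \<comment> \<open>The threshold \<open>r N\<close> is chosen so that \<open>r N powr (\<beta> - \<alpha>)\<close> dominates the constant of order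
    \<open>N\<close> that the one-step estimate requires for step size \<open>T / N\<close>.\<close>
  define q where "q = 1 / (\<beta> - \<alpha>)"
  define R where "R = 2 + C + (C * (2 / T + 2 * C)) powr q"
  define r where "r N = R * real N powr q" for N :: nat
  have q: "0 \<le> q" "q * (\<beta> - \<alpha>) = 1" using \<open>\<beta> > \<alpha>\<close> by (auto simp: q_def)
  have R: "2 + C \<le> R" "(C * (2 / T + 2 * C)) powr q \<le> R" using \<open>C \<ge> 1\<close> by (auto simp: R_def)
  have Nq: "1 \<le> real N powr q" if "N \<ge> 1" for N
    using that q by (simp add: ge_one_powr_ge_zero)
  have r: "2 \<le> r N" "C \<le> r N" "C * (2 / (T / real N) + 2 * C) \<le> r N powr (\<beta> - \<alpha>)"
    if N: "N \<ge> 1" for N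
  proof -
    have "R * 1 \<le> r N" unfolding r_def using R Nq[OF N] \<open>C \<ge> 1\<close> by (intro mult_left_mono) auto
    then show "2 \<le> r N" "C \<le> r N" using R \<open>C \<ge> 1\<close> by auto
    have "C * (2 * C) * 1 \<le> C * (2 * C) * real N"
      using N \<open>C \<ge> 1\<close> by (intro mult_left_mono) auto
    then have "C * (2 / (T / real N) + 2 * C) \<le> C * (2 / T + 2 * C) * real N"
      by (simp add: algebra_simps)
    also have "\<dots> = ((C * (2 / T + 2 * C)) powr q * real N powr q) powr (\<beta> - \<alpha>)"
      using \<open>C \<ge> 1\<close> \<open>0 < T\<close> N q by (simp add: powr_mult powr_powr)
    also have "\<dots> \<le> r N powr (\<beta> - \<alpha>)"
      unfolding r_def using R \<open>\<beta> > \<alpha>\<close> by (intro powr_mono2 mult_right_mono) auto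
    finally show "C * (2 / (T / real N) + 2 * C) \<le> r N powr (\<beta> - \<alpha>)" .
  qed
  define a where "a N = K * (r N + K)" for N
  have a0: "0 \<le> a N" if "N \<ge> 1" for N using r(1)[OF that] K(1) by (simp add: a_def)
  have a1: "a N + 1 \<le> (K * (R + K) + 1) * real N powr q" if "N \<ge> 1" for N
  proof -
    have "(K * K + 1) * 1 \<le> (K * K + 1) * real N powr q"
      using Nq[OF that] by (intro mult_left_mono) auto
    then show ?thesis by (simp add: a_def r_def algebra_simps)
  qed
  define \<Omega> where "\<Omega> N = {\<omega> \<in> A. \<forall>k<N.
      W (real (Suc k) * T / real N) \<omega> - W (real k * T / real N) \<omega>
        \<in> (if k = 0 then {a N..a N + 1} else {T / real N..2 * (T / real N)})}" for N
  define m where "m = 2 * q + 2"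
  obtain L where L: "L \<ge> 0"
    and \<Omega>: "\<And>N. N \<ge> 1 \<Longrightarrow> \<Omega> N \<in> sets M"
      "\<And>N. N \<ge> 1 \<Longrightarrow> exp (- L * real N powr m) \<le> prob (\<Omega> N)"
    using excursion_event_prob_ge[OF A K(2)[folded A_def] a0 a1 q(1)]
    unfolding \<Omega>_def[symmetric] m_def by blast
  have large: "2 powr (\<alpha> ^ (N - 1)) \<le> \<bar>euler_approx T W \<xi> \<mu> \<sigma> N N \<omega>\<bar>"
    if N: "N \<ge> 1" and \<omega>: "\<omega> \<in> \<Omega> N" for N \<omega>
  proof (rule euler_doubly_exponential_growth[where C = C and \<beta> = \<beta> and r = "r N" and K = K])
    have "W (real (Suc 0) * T / real N) \<omega> - W (real 0 * T / real N) \<omega> \<in> {a N..a N + 1}"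
      using \<omega> N by (force simp: \<Omega>_def)
    then show "K * (r N + K) \<le> W (real (Suc 0) * T / real N) \<omega> - W (real 0 * T / real N) \<omega>"
      by (simp add: a_def)
    show "W (real (Suc k) * T / real N) \<omega> - W (real k * T / real N) \<omega>
        \<in> {T / real N..2 * (T / real N)}" if "1 \<le> k" "k < N" for k
      using \<omega> that by (force simp: \<Omega>_def)
  qed (use assms N K r[OF N] \<omega> in \<open>auto simp: \<Omega>_def A_def\<close>)
  have part1: "\<exists>c>1. \<exists>\<Omega> :: nat \<Rightarrow> 'a set. \<forall>N\<ge>1.
            \<Omega> N \<in> sets M \<and> \<Omega> N \<noteq> {} \<and>
            measure M (\<Omega> N) \<ge> c powr (- (real N powr c)) \<and>
            (\<forall>\<omega>\<in>\<Omega> N. \<bar>euler_approx T W \<xi> \<mu> \<sigma> N N \<omega>\<bar> \<ge> 2 powr (\<alpha> ^ (N - 1)))"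
  proof -
    obtain c where c: "c > 1"
        "\<And>N. N \<ge> 1 \<Longrightarrow> c powr (- (real N powr c)) \<le> exp (- L * real N powr m)"
      using exp_poly_bound_as_single_constant[OF L, of m] by blast
    have "\<Omega> N \<noteq> {}" if "N \<ge> 1" for N
      using \<Omega>(2)[OF that] by (metis exp_gt_zero measure_empty not_less)
    moreover have "c powr (- (real N powr c)) \<le> prob (\<Omega> N)" if "N \<ge> 1" for N
      using c(2)[OF that] \<Omega>(2)[OF that] by linarith
    ultimately show ?thesis
      using c(1) \<Omega>(1) large by (intro exI[of _ c] exI[of _ \<Omega>] conjI allI impI ballI)
  qed
  have lim: "filterlim (\<lambda>N. 2 powr (\<alpha> ^ (N - 1)) * prob (\<Omega> N)) at_top sequentially"
    using doubly_exponential_beats_exp_poly[OF \<open>\<alpha> > 1\<close>, of L m]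
    by (rule filterlim_at_top_mono)
      (rule eventually_sequentiallyI[of 1], rule mult_left_mono[OF \<Omega>(2)], simp_all)
  have v: "1 \<le> 2 powr (\<alpha> ^ (N - 1))" for N
    using \<open>\<alpha> > 1\<close> by (simp add: ge_one_powr_ge_zero)
  note moments = moments_diverge[OF predictable_process_measurable_end[OF assms(8)]
      euler_approx_measurable[OF \<xi> \<mu>\<sigma> _ order_refl] \<Omega>(1) large v lim]
  show ?thesis
    using part1 moments by blast
qed

end
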